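(* Let $M\ge1$ be an integer, let $G$ be a connected $M$-good expander and let $v_0\in V(G)$. Let $f$ be a uniformly random element of $\mathrm{Lip}_{v_0}(G;M)$. Then for every positive integer $t$ and every $v\in V(G)$, $$\mathbb{P}\big(\mathrm{dist}(f(v),\mathrm{phase}(f))>(t-1)M\big)\le \exp\left(-\frac{|B(v,t)|}{5(M+1)}\right).$$
   Context: Graphs are finite, simple and undirected; $d\ge1$ is an integer, $\lambda$ a real number, and $\log$ is the natural logarithm. For a graph $G$, $v_0\in V(G)$ and a positive integer $M$, $\mathrm{Lip}_{v_0}(G;M)$ is the set of all $f:V(G)\to\mathbb{Z}$ with $f(v_0)=0$ and $|f(u)-f(v)|\le M$ for every edge $\{u,v\}$ of $G$ (a finite set when $G$ is finite and connected). For $S,T\subseteq V(G)$, $e(S,T)$ is the number of pairs $(a,b)\in S\times T$ with $\{a,b\}\in E(G)$. A $d$-regular $n$-vertex graph $G$ is a $\lambda$-expander if $\left|e(S,T)-\frac dn|S||T|\right|\le\lambda\sqrt{|S||T|}$ for all $S,T\subseteq V(G)$. $G$ is an $M$-good expander if it is a $d$-regular $\lambda$-expander with $\lambda\le\frac{d}{32(M+1)\log(9Md^2)}$. Phase: fix an assignment $f\mapsto\mathrm{phase}(f)$ which associates to each $f\in\mathrm{Lip}_{v_0}(G;M)$ not identically zero an interval $\{k,k+1,\ldots,k+M\}$, $k\in\mathbb{Z}$, with $|\{w\in V(G): f(w)\notin\{k,\ldots,k+M\}\}|\le\frac{2\lambda n}{d}$, in such a manner that $\mathrm{phase}(-f)=-\mathrm{phase}(f)$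 (such an assignment exists on every $d$-regular $n$-vertex $\lambda$-expander); the phase of the zero function is defined to be $\{0\}$. $B(v,t)$ is the ball of radius $t$ around $v$ in the graph metric of $G$: the set of vertices at distance at most $t$ from $v$. For $b\in\mathbb{Z}$ and nonempty $A\subseteq\mathbb{Z}$, $\mathrm{dist}(b,A)=\min_{a\in A}|b-a|$. *)

theory Defs
  imports "HOL-Probability.Probability" "Graph_Theory.Graph_Theory"
begin

text \<open>
  A finite simple undirected graph is a structure \<open>G\<close> satisfying \<open>pair_graph G\<close>: its arc set
  \<open>parcs G\<close> is a symmetric irreflexive relation on the finite set \<open>pverts G\<close>, every edge
  \<open>{a, b}\<close> being represented by the two arcs \<open>(a, b)\<close> and \<open>(b, a)\<close>.
\<close>

definition edge_count :: "'a pair_pre_digraph \<Rightarrow> 'a set \<Rightarrow> 'a set \<Rightarrow> nat" where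
  "edge_count G S T = card {(a, b). a \<in> S \<and> b \<in> T \<and> (a, b) \<in> parcs G}"

definition regular_graph :: "nat \<Rightarrow> 'a pair_pre_digraph \<Rightarrow> bool" where
  "regular_graph d G \<longleftrightarrow> (\<forall>v \<in> pverts G. out_degree (with_proj G) v = d)"

definition expander :: "nat \<Rightarrow> real \<Rightarrow> 'a pair_pre_digraph \<Rightarrow> bool" where
  "expander d lam G \<longleftrightarrow> regular_graph d G \<and>
     (\<forall>S T. S \<subseteq> pverts G \<longrightarrow> T \<subseteq> pverts G \<longrightarrow>
        \<bar>real (edge_count G S T) - real d / real (card (pverts G)) * real (card S) * real (card T)\<bar>
          \<le> lam * sqrt (real (card S) * real (card T)))"

definition good_expander :: "nat \<Rightarrow> nat \<Rightarrow> real \<Rightarrow> 'a pair_pre_digraph \<Rightarrow> bool" where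
  "good_expander M d lam G \<longleftrightarrow> expander d lam G \<and>
     lam \<le> real d / (32 * (real M + 1) * ln (9 * real M * (real d)^2))"

text \<open>
  Functions on the vertex set are taken extensional, i.e. \<open>undefined\<close> outside \<open>pverts G\<close>, so that
  each function on the vertices is represented exactly once.
\<close>

definition Lip :: "'a pair_pre_digraph \<Rightarrow> 'a \<Rightarrow> nat \<Rightarrow> ('a \<Rightarrow> int) set" where
  "Lip G v0 M = {f \<in> pverts G \<rightarrow>\<^sub>E UNIV.
     f v0 = 0 \<and> (\<forall>(u, v) \<in> parcs G. \<bar>f u - f v\<bar> \<le> int M)}"

definition phase_assignment ::
  "'a pair_pre_digraph \<Rightarrow> nat \<Rightarrow> real \<Rightarrow> 'a \<Rightarrow> nat \<Rightarrow> (('a \<Rightarrow> int) \<Rightarrow> int set) \<Rightarrow> bool" where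
  "phase_assignment G d lam v0 M phase \<longleftrightarrow>
     (\<forall>f \<in> Lip G v0 M. (\<exists>w \<in> pverts G. f w \<noteq> 0) \<longrightarrow>
        (\<exists>k. phase f = {k..k + int M} \<and>
             real (card {w \<in> pverts G. f w \<notin> {k..k + int M}})
               \<le> 2 * lam * real (card (pverts G)) / real d)) \<and>
     (\<forall>f \<in> Lip G v0 M. phase (\<lambda>w \<in> pverts G. - f w) = uminus ` phase f) \<and>
     phase (\<lambda>w \<in> pverts G. 0) = {0}"

text \<open>The graph metric is the library's shortest-path distance with unit arc weights.\<close>

definition graph_ball :: "'a pair_pre_digraph \<Rightarrow> 'a \<Rightarrow> nat \<Rightarrow> 'a set" where
  "graph_ball G v t =
     {w \<in> pverts G. wf_digraph.\<mu> (with_proj G) (\<lambda>_. 1) v w \<le> ereal (real t)}"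

text \<open>On the integers the infimum of a nonempty set bounded below is its minimum.\<close>

definition int_dist :: "int \<Rightarrow> int set \<Rightarrow> int" where
  "int_dist b A = (INF a \<in> A. \<bar>b - a\<bar>)"

end

theory Submission
  imports Defs
begin

text \<open>
  Fix the phase to be \<open>{0..M}\<close> by translating \<open>f\<close> instead of fixing \<open>f v\<^sub>0 = 0\<close>, so that one works with
  the family of \<open>centred\<close> functions: all Lipschitz \<open>g\<close> with at most \<open>2 \<lambda> n / d\<close> values outside
  \<open>{0..M}\<close>. Two translates of one function that are both centred differ by at most \<open>M\<close>, since the
  sets on which they lie in \<open>{0..M}\<close> must meet; so this changes cardinalities by a factor of at most
  \<open>M + 1\<close>. The reflection \<open>g \<mapsto> M - g\<close> preserves the family, so only \<open>g v > t M\<close> has to be treated.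

  For such \<open>g\<close> let \<open>A\<close> be the component of \<open>v\<close> in \<open>{g > M}\<close>, two vertices being joined when their
  distance is at most 2. Descending from \<open>v\<close> in steps of at most \<open>M\<close> shows that \<open>A\<close> together with its
  outer boundary \<open>D\<close> contains the ball of radius \<open>t\<close>. On \<open>D\<close> the values of \<open>g\<close> are in \<open>{1..M}\<close>, and,
  because of the distance-2 connectivity, all neighbours of \<open>D\<close> outside \<open>A\<close> have values at most
  \<open>M\<close>. After replacing \<open>g\<close> by 0 on \<open>A\<close>, each vertex of \<open>D\<close> can therefore be
  lowered to 0, independently of the others: every vertex of \<open>D\<close> that is forced to have a value in \<open>{1..M}\<close> rather than
  \<open>{0..M}\<close> costs a factor \<open>M / (M + 1)\<close> in the number of functions. The values on \<open>A\<close> which this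
  forgets are at most \<open>(5 M) ^ |A|\<close> many. Hence the functions with a given \<open>A\<close> make up a proportion of at most
  \<open>(5 M) ^ |A| * exp (- |D| / (M + 1))\<close> (lemma \<open>card_above_le\<close>).

  Put \<open>L = ln (9 M d\<^sup>2)\<close>. As \<open>A\<close> has at most \<open>2 \<lambda> n / d\<close> elements, the expander inequality for the
  pair \<open>A\<close>, \<open>A \<union> D\<close> forces \<open>|A \<union> D| \<ge> 14 (M + 1) L |A|\<close> (lemma \<open>vertex_expansion\<close>). A fifth of the exponent is
  spent on the ball, which is contained in \<open>A \<union> D\<close>; the rest beats \<open>(5 M) ^ |A|\<close>, the at most \<open>exp (2 L |A|)\<close>
  possible sets \<open>A\<close> of each size, and the factor \<open>2 (M + 1)\<close> lost by centring and reflecting.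
\<close>

section \<open>Connected sets of a relation\<close>

text \<open>
  Connectedness by cuts rather than by paths, so that a connected set can at once be grown one vertex
  at a time from any of its points.
\<close>

definition cut_connected :: "'a rel \<Rightarrow> 'a set \<Rightarrow> bool" where
  "cut_connected R A \<longleftrightarrow> (\<forall>B\<subseteq>A. B \<noteq> {} \<longrightarrow> B \<noteq> A \<longrightarrow> (\<exists>p\<in>B. \<exists>x\<in>A - B. (p, x) \<in> R))"

lemma cut_connected_induct [consumes 3, case_names root grow]:
  assumes "finite A" "cut_connected R A" "a \<in> A"
    and root: "P {a}"
    and grow: "\<And>B p x. a \<in> B \<Longrightarrow> B \<subseteq> A \<Longrightarrow> p \<in> B \<Longrightarrow> x \<in> A - B \<Longrightarrow> (p, x) \<in> R \<Longrightarrow> P B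
                 \<Longrightarrow> P (insert x B)"
  shows "P A"
proof -
  have "\<exists>B. a \<in> B \<and> B \<subseteq> A \<and> P B \<and> card B = Suc k" if "Suc k \<le> card A" for k
    using that
  proof (induction k)
    case 0
    then show ?case using \<open>a \<in> A\<close> root by (intro exI[of _ "{a}"]) auto
  next
    case (Suc k)
    then obtain B where B: "a \<in> B" "B \<subseteq> A" "P B" "card B = Suc k" by auto
    then have "B \<noteq> {}" "B \<noteq> A" using Suc.prems by auto
    with \<open>cut_connected R A\<close> B obtain p x where px: "p \<in> B" "x \<in> A - B" "(p, x) \<in> R"
      unfolding cut_connected_def by blast
    have "finite B" using B \<open>finite A\<close> finite_subset by blast
    then have "card (insert x B) = Suc (Suc k)" using B px by auto
    with grow[OF B(1,2) px B(3)] B px show ?case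
      by (intro exI[of _ "insert x B"]) auto
  qed
  moreover have "card A > 0" using assms(1,3) by (auto simp: card_gt_0_iff)
  ultimately obtain B where "B \<subseteq> A" "P B" "card B = card A"
    by (metis Suc_pred order_refl)
  then show ?thesis using card_subset_eq[OF \<open>finite A\<close>] by metis
qed

text \<open>
  If no pair of \<open>R\<close> led from \<open>B\<close> to the rest of the component, then by symmetry none would lead back
  either, so membership in \<open>B\<close> would be constant along every path from \<open>v\<close>.
\<close>

lemma cut_connected_component:
  assumes "sym R" "v \<in> U"
  shows "cut_connected R ((R \<inter> U \<times> U)\<^sup>* `` {v})"
  unfolding cut_connected_def
proof (intro allI impI, rule ccontr)
  let ?A = "(R \<inter> U \<times> U)\<^sup>* `` {v}"
  fix B assume B: "B \<subseteq> ?A" "B \<noteq> {}" "B \<noteq> ?A"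
    and no: "\<not> (\<exists>p\<in>B. \<exists>x\<in>?A - B. (p, x) \<in> R)"
  have step: "x \<in> ?A" if "y \<in> ?A" "(y, x) \<in> R \<inter> U \<times> U" for x y
    using that by (auto intro: rtrancl_into_rtrancl)
  have "x \<in> B \<longleftrightarrow> v \<in> B" if "(v, x) \<in> (R \<inter> U \<times> U)\<^sup>*" for x
    using that
  proof (induction rule: rtrancl_induct)
    case (step y z)
    have "y \<in> ?A" "z \<in> ?A" using step.hyps by (auto intro: rtrancl_into_rtrancl)
    moreover have "(y, z) \<in> R" "(z, y) \<in> R" using step.hyps \<open>sym R\<close> by (auto dest: symD)
    ultimately have "z \<in> B \<longleftrightarrow> y \<in> B" using no by blast
    with step.IH show ?case by simp
  qed simp
  with B show False by blast
qed

text \<open>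
  Each vertex \<open>x\<close> added next to \<open>p\<close> is visited by the detour \<open>p, x, p\<close>, which lengthens the walk by 2.
  The walk encodes the set, so counting walks bounds the number of connected sets.
\<close>

lemma cut_connected_walk:
  assumes "finite A" "cut_connected R A" "sym R" "v \<in> A"
  shows "\<exists>xs. length xs = 2 * card A - 1 \<and> xs \<noteq> [] \<and> hd xs = v
           \<and> successively (\<lambda>x y. (x, y) \<in> R) xs \<and> set xs = A"
  using assms(1,2,4)
proof (induction rule: cut_connected_induct)
  case root
  show ?case by (intro exI[of _ "[v]"]) auto
next
  case (grow B p x)
  then obtain xs where xs: "length xs = 2 * card B - 1" "xs \<noteq> []" "hd xs = v"
    "successively (\<lambda>x y. (x, y) \<in> R) xs" "set xs = B" by blast
  from grow xs obtain ys zs where yz: "xs = ys @ p # zs"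
    by (metis split_list)
  have "(x, p) \<in> R" using grow \<open>sym R\<close> by (auto dest: symD)
  have finB: "finite B" using grow \<open>finite A\<close> finite_subset by blast
  then have cB: "card B > 0" using grow by (auto simp: card_gt_0_iff)
  let ?ws = "ys @ p # x # p # zs"
  have "successively (\<lambda>x y. (x, y) \<in> R) ?ws"
    using xs(4) \<open>(p, x) \<in> R\<close> \<open>(x, p) \<in> R\<close> unfolding yz
    by (auto simp: successively_append_iff)
  moreover have "length ?ws = 2 * card (insert x B) - 1"
    using xs(1) grow finB cB unfolding yz by auto
  moreover have "hd ?ws = v" using xs(3) unfolding yz by (cases ys) auto
  moreover have "set ?ws = insert x B" using xs(5) unfolding yz by auto
  ultimately show ?case by (intro exI[of _ ?ws]) auto
qed

lemma card_walks_le: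
  assumes "\<And>x. finite (R `` {x})" "\<And>x. card (R `` {x}) \<le> \<Delta>"
  shows "finite {xs. length xs = Suc l \<and> hd xs = v \<and> successively (\<lambda>x y. (x, y) \<in> R) xs}
       \<and> card {xs. length xs = Suc l \<and> hd xs = v \<and> successively (\<lambda>x y. (x, y) \<in> R) xs} \<le> \<Delta> ^ l"
proof (induction l arbitrary: v)
  case 0
  have "{xs. length xs = Suc 0 \<and> hd xs = v \<and> successively (\<lambda>x y. (x, y) \<in> R) xs} = {[v]}"
    by (auto simp: length_Suc_conv)
  then show ?case by simp
next
  case (Suc l)
  let ?W = "\<lambda>l v. {xs. length xs = Suc l \<and> hd xs = v \<and> successively (\<lambda>x y. (x, y) \<in> R) xs}"
  have eq: "?W (Suc l) v = (\<Union>y\<in>R `` {v}. (#) v ` ?W l y)"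
  proof (intro equalityI subsetI)
    fix xs assume "xs \<in> ?W (Suc l) v"
    then obtain y ys where "xs = v # y # ys" "length ys = l" "(v, y) \<in> R"
      "successively (\<lambda>x y. (x, y) \<in> R) (y # ys)"
      by (auto simp: length_Suc_conv)
    then show "xs \<in> (\<Union>y\<in>R `` {v}. (#) v ` ?W l y)"
      by (intro UN_I[of y] image_eqI[of _ _ "y # ys"]) auto
  qed (auto simp: length_Suc_conv)
  have "card (?W (Suc l) v) \<le> (\<Sum>y\<in>R `` {v}. card ((#) v ` ?W l y))"
    unfolding eq using assms(1) by (rule card_UN_le)
  also have "\<dots> \<le> (\<Sum>y\<in>R `` {v}. \<Delta> ^ l)"
    by (intro sum_mono le_trans[OF card_image_le]) (use Suc in auto)
  also have "\<dots> \<le> \<Delta> ^ Suc l" using assms(2)[of v] by simp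
  finally show ?case using assms(1) Suc unfolding eq by auto
qed

lemma card_cut_connected_le:
  assumes "\<And>x. finite (R `` {x})" "\<And>x. card (R `` {x}) \<le> \<Delta>" "sym R" "a > 0"
  shows "finite {A. finite A \<and> cut_connected R A \<and> v \<in> A \<and> card A = a}
       \<and> card {A. finite A \<and> cut_connected R A \<and> v \<in> A \<and> card A = a} \<le> \<Delta> ^ (2 * (a - 1))"
proof -
  let ?W = "{xs. length xs = Suc (2 * (a - 1)) \<and> hd xs = v \<and> successively (\<lambda>x y. (x, y) \<in> R) xs}"
  let ?C = "{A. finite A \<and> cut_connected R A \<and> v \<in> A \<and> card A = a}"
  have W: "finite ?W" "card ?W \<le> \<Delta> ^ (2 * (a - 1))"
    using card_walks_le[OF assms(1,2)] by auto
  have sub: "?C \<subseteq> set ` ?W"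
  proof
    fix A assume "A \<in> ?C"
    then have A: "finite A" "cut_connected R A" "v \<in> A" "card A = a" by auto
    have "2 * a - 1 = Suc (2 * (a - 1))" using \<open>a > 0\<close> by simp
    with cut_connected_walk[OF A(1,2) \<open>sym R\<close> A(3)] A(4) show "A \<in> set ` ?W" by auto
  qed
  show ?thesis
    using finite_subset[OF sub] card_mono[OF _ sub] card_image_le[OF W(1), of set] W by auto
qed

text \<open>
  While \<open>A\<close> grows from \<open>a\<close>, the value at each new vertex is within \<open>K\<close> of a value already known. The
  set \<open>I\<close> collects the values that are possible at the root.
\<close>

lemma card_lipschitz_on_cut_connected_le:
  fixes F :: "('a \<Rightarrow> int) set" and K :: nat
  assumes "finite A" "cut_connected R A" "a \<in> A"
    and I: "finite I" "\<And>f. f \<in> F \<Longrightarrow> f a \<in> I"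
    and lip: "\<And>f p q. f \<in> F \<Longrightarrow> p \<in> A \<Longrightarrow> q \<in> A \<Longrightarrow> (p, q) \<in> R \<Longrightarrow> \<bar>f p - f q\<bar> \<le> int K"
  shows "finite ((\<lambda>f. restrict f A) ` F)
       \<and> card ((\<lambda>f. restrict f A) ` F) \<le> card I * (2 * K + 1) ^ (card A - 1)"
  using assms(1,2,3)
proof (induction rule: cut_connected_induct)
  case root
  have sub: "(\<lambda>f. restrict f {a}) ` F \<subseteq> (\<lambda>i. \<lambda>x\<in>{a}. i) ` I"
  proof
    fix h assume "h \<in> (\<lambda>f. restrict f {a}) ` F"
    then obtain f where "f \<in> F" "h = restrict f {a}" by auto
    then show "h \<in> (\<lambda>i. \<lambda>x\<in>{a}. i) ` I"
      using I(2) by (intro image_eqI[of _ _ "f a"]) (auto simp: fun_eq_iff restrict_def)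
  qed
  have "card ((\<lambda>f. restrict f {a}) ` F) \<le> card I"
    using card_mono[OF finite_imageI[OF I(1)] sub] card_image_le[OF I(1)] by (rule le_trans)
  then show ?case
    using finite_subset[OF sub finite_imageI[OF I(1)]] by (metis card_1_singleton_iff
        One_nat_def diff_self_eq_0 mult.right_neutral power_0)
next
  case (grow B p x)
  let ?r = "\<lambda>B. (\<lambda>f. restrict f B) ` F"
  have finB: "finite B" using grow \<open>finite A\<close> finite_subset by blast
  then have cB: "card B > 0" using grow by (auto simp: card_gt_0_iff)
  have sub: "?r (insert x B) \<subseteq> (\<lambda>(h, i). h(x := h p + i)) ` (?r B \<times> {- int K..int K})"
  proof
    fix h assume "h \<in> ?r (insert x B)"
    then obtain f where f: "f \<in> F" "h = restrict f (insert x B)" by auto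
    have "\<bar>f p - f x\<bar> \<le> int K" using lip[OF f(1)] grow by blast
    then show "h \<in> (\<lambda>(h, i). h(x := h p + i)) ` (?r B \<times> {- int K..int K})"
      using f grow by (intro image_eqI[of _ _ "(restrict f B, f x - f p)"])
        (auto simp: fun_eq_iff restrict_def)
  qed
  have fin: "finite (?r B \<times> {- int K..int K})"
    by (rule finite_cartesian_product[OF conjunct1[OF grow.IH]]) simp
  have "card (?r (insert x B)) \<le> card (?r B \<times> {- int K..int K})"
    using card_mono[OF finite_imageI[OF fin] sub] card_image_le[OF fin] by (rule le_trans)
  also have "\<dots> = card (?r B) * (2 * K + 1)"
  proof -
    have "card {- int K..int K} = 2 * K + 1" by simp
    then show ?thesis by (simp only: card_cartesian_product)
  qed
  also have "\<dots> \<le> card I * (2 * K + 1) ^ (card B - 1) * (2 * K + 1)"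
    by (intro mult_right_mono conjunct2[OF grow.IH]) simp
  also have "\<dots> = card I * (2 * K + 1) ^ (card (insert x B) - 1)"
  proof -
    have "card (insert x B) - 1 = Suc (card B - 1)" using grow.hyps finB cB by simp
    then show ?thesis by (simp only: power_Suc mult_ac)
  qed
  finally show ?case using finite_subset[OF sub finite_imageI[OF fin]] by blast
qed

section \<open>Expanders and flattening\<close>

locale regular_expander =
  fixes V :: "'a set" and E :: "'a rel" and d :: nat and lam :: real
  assumes finV: "finite V" and EV: "E \<subseteq> V \<times> V" and symE: "sym E"
    and degree: "x \<in> V \<Longrightarrow> card (E `` {x}) = d" and d_pos: "d > 0"
    and mixing: "S \<subseteq> V \<Longrightarrow> T \<subseteq> V \<Longrightarrow>
      real (card (E \<inter> S \<times> T)) \<le> real d / real (card V) * real (card S) * real (card T)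
        + lam * sqrt (real (card S) * real (card T))"
begin

definition within_two :: "'a rel" where
  "within_two = E \<union> E O E"

definition boundary :: "'a set \<Rightarrow> 'a set" where
  "boundary A = E `` A - A"

lemma E_sym: "(x, y) \<in> E \<Longrightarrow> (y, x) \<in> E"
  using symE by (rule symD)

lemma E_in_V: "(x, y) \<in> E \<Longrightarrow> x \<in> V \<and> y \<in> V"
  using EV by auto

lemma boundary_subset: "boundary A \<subseteq> V"
  using EV by (auto simp: boundary_def)

lemma sym_within_two: "sym within_two"
  unfolding within_two_def by (intro symI) (use E_sym in blast)

lemma finite_within_two: "finite (within_two `` {x})"
  by (rule finite_subset[OF _ finV]) (use EV in \<open>auto simp: within_two_def\<close>)

lemma card_within_two_le: "card (within_two `` {x}) \<le> 2 * d\<^sup>2"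
proof (cases "x \<in> V")
  case False
  then have "within_two `` {x} = {}" using EV by (auto simp: within_two_def)
  then show ?thesis by simp
next
  case True
  have fin: "finite (E `` {y})" for y by (rule finite_subset[OF _ finV]) (use EV in auto)
  have eq: "within_two `` {x} = E `` {x} \<union> (\<Union>y\<in>E `` {x}. E `` {y})" by (auto simp: within_two_def)
  have "card (\<Union>y\<in>E `` {x}. E `` {y}) \<le> (\<Sum>y\<in>E `` {x}. card (E `` {y}))"
    by (rule card_UN_le[OF fin])
  also have "\<dots> = (\<Sum>y\<in>E `` {x}. d)" by (rule sum.cong) (use EV degree in auto)
  also have "\<dots> = d\<^sup>2" using degree True by (simp add: power2_eq_square)
  finally have *: "card (\<Union>y\<in>E `` {x}. E `` {y}) \<le> d\<^sup>2" .
  have "card (within_two `` {x}) \<le> card (E `` {x}) + card (\<Union>y\<in>E `` {x}. E `` {y})"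
    unfolding eq by (rule card_Un_le)
  also have "\<dots> \<le> d + d\<^sup>2" using degree[OF True] * by simp
  also have "\<dots> \<le> 2 * d\<^sup>2" using d_pos by (simp add: power2_eq_square)
  finally show ?thesis .
qed

lemma card_edges_from:
  assumes "A \<subseteq> V"
  shows "card (E \<inter> A \<times> (A \<union> boundary A)) = d * card A"
proof -
  have "E \<inter> A \<times> (A \<union> boundary A) = Sigma A (\<lambda>x. E `` {x})" by (auto simp: boundary_def)
  then have "card (E \<inter> A \<times> (A \<union> boundary A)) = (\<Sum>x\<in>A. card (E `` {x}))"
    using assms finV EV by (auto intro!: card_SigmaI finite_subset[OF _ finV])
  also have "\<dots> = (\<Sum>x\<in>A. d)" by (rule sum.cong) (use assms degree in auto)
  finally show ?thesis by simp
qed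

text \<open>
  All \<open>d |A|\<close> edges at \<open>A\<close> end in \<open>A \<union> D\<close>, where \<open>D\<close> is the boundary. If \<open>|A \<union> D| < 14 P |A|\<close>, then the
  two terms of the expander inequality are at most \<open>14/16\<close> and \<open>1/16\<close> of \<open>d |A|\<close>, the first because
  \<open>|A| / n \<le> 2 \<lambda> / d \<le> 1 / (16 P)\<close>, the second because \<open>sqrt (14 P) \<le> 2 P\<close>. In the application
  \<open>P = (M + 1) L\<close>.
\<close>

lemma vertex_expansion:
  fixes P :: real
  assumes P: "P \<ge> 4" "lam \<le> d / (32 * P)"
    and A: "A \<subseteq> V" "card A \<le> 2 * lam * card V / d"
  shows "real (card (A \<union> boundary A)) \<ge> 14 * P * card A"
proof (rule ccontr)
  assume neg: "\<not> ?thesis"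
  define a m n where "a = real (card A)" and "m = real (card (A \<union> boundary A))" and "n = real (card V)"
  have m: "m < 14 * P * a" using neg by (simp add: m_def a_def)
  have "m \<ge> 0" by (simp add: m_def)
  with m P have a: "a > 0" by (smt (verit) zero_less_mult_iff a_def of_nat_0_le_iff)
  then have "card V \<ge> card A" "card A > 0" using A card_mono[OF finV] by (auto simp: a_def)
  then have n: "n > 0" by (simp add: n_def)
  have d: "real d > 0" using d_pos by simp
  have "a / n \<le> 2 * lam / d" using A(2) n d by (simp add: a_def n_def field_simps)
  also have "\<dots> \<le> 2 * (d / (32 * P)) / d" using P d by (intro divide_right_mono mult_left_mono) auto
  also have "\<dots> = 1 / (16 * P)" using d P by (simp add: field_simps)
  finally have an: "a / n \<le> 1 / (16 * P)" .
  have t1: "d / n * a * m \<le> d * (14 / 16 * a)"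
  proof -
    have "d / n * a * m = d * ((a / n) * m)" by simp
    also have "\<dots> \<le> d * (1 / (16 * P) * (14 * P * a))"
      using an m d P a \<open>m \<ge> 0\<close> by (intro mult_left_mono mult_mono) auto
    also have "\<dots> = d * (14 / 16 * a)" using P by simp
    finally show ?thesis .
  qed
  have "sqrt (a * m) \<le> sqrt ((2 * P * a)\<^sup>2)"
  proof (rule real_sqrt_le_mono)
    have "a * m \<le> a * (14 * P * a)" using m a by (intro mult_left_mono) auto
    also have "\<dots> = 14 * P * a\<^sup>2" by (simp add: power2_eq_square)
    also have "\<dots> \<le> (4 * P) * P * a\<^sup>2" using P a by (intro mult_right_mono) auto
    finally show "a * m \<le> (2 * P * a)\<^sup>2" by (simp add: power2_eq_square mult_ac)
  qed
  then have sq: "sqrt (a * m) \<le> 2 * P * a" using P a by simp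
  have t2: "lam * sqrt (a * m) \<le> d * (1 / 16 * a)"
  proof -
    have "lam * sqrt (a * m) \<le> d / (32 * P) * sqrt (a * m)"
      using P a \<open>m \<ge> 0\<close> by (intro mult_right_mono) auto
    also have "\<dots> \<le> d / (32 * P) * (2 * P * a)" using sq P by (intro mult_left_mono) auto
    also have "\<dots> = d * (1 / 16 * a)" using P by simp
    finally show ?thesis .
  qed
  have "d * a \<le> d / n * a * m + lam * sqrt (a * m)"
    using mixing[OF A(1), of "A \<union> boundary A"] A(1) boundary_subset card_edges_from[OF A(1)]
    by (simp add: a_def m_def n_def)
  also have "\<dots> \<le> d * (14 / 16 * a) + d * (1 / 16 * a)" using t1 t2 by (rule add_mono)
  also have "\<dots> = 15 / 16 * (d * a)" by simp
  finally show False using mult_pos_pos[OF d a] by linarith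
qed

definition lipschitz :: "nat \<Rightarrow> ('a \<Rightarrow> int) set" where
  "lipschitz M = {g \<in> V \<rightarrow>\<^sub>E UNIV. \<forall>(x, y)\<in>E. \<bar>g x - g y\<bar> \<le> int M}"

definition centred :: "nat \<Rightarrow> ('a \<Rightarrow> int) set" where
  "centred M = {g \<in> lipschitz M.
     real (card {w \<in> V. g w \<notin> {0..int M}}) \<le> 2 * lam * real (card V) / real d}"

text \<open>
  The functions for which \<open>A\<close> is a union of components of \<open>{g > M}\<close> with respect to distance at most
  2; the last condition says that no vertex of \<open>{g > M}\<close> outside \<open>A\<close> has a neighbour in common with
  \<open>A\<close>.
\<close>

definition above :: "nat \<Rightarrow> 'a set \<Rightarrow> ('a \<Rightarrow> int) set" where
  "above M A = {g \<in> centred M. (\<forall>x\<in>A. g x > int M) \<and> (\<forall>b\<in>boundary A. g b \<le> int M) \<and>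
     (\<forall>b\<in>boundary A. \<forall>y. (b, y) \<in> E \<longrightarrow> y \<notin> A \<longrightarrow> g y \<le> int M)}"

text \<open>
  An intermediate stage of the lowering: \<open>A\<close> is flattened to 0, boundary vertices may be lowered to 0 as
  well, but those in \<open>B\<close> must still be at least 1.
\<close>

definition flat :: "nat \<Rightarrow> 'a set \<Rightarrow> 'a set \<Rightarrow> ('a \<Rightarrow> int) set" where
  "flat M A B = {g \<in> centred M. (\<forall>x\<in>A. g x = 0) \<and> (\<forall>b\<in>boundary A. g b \<in> {0..int M}) \<and>
     (\<forall>b\<in>boundary A. \<forall>y. (b, y) \<in> E \<longrightarrow> g y \<le> int M) \<and> (\<forall>b\<in>B. g b \<ge> 1)}"

lemma lipschitzD: "g \<in> lipschitz M \<Longrightarrow> (x, y) \<in> E \<Longrightarrow> \<bar>g x - g y\<bar> \<le> int M"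
  by (auto simp: lipschitz_def)

lemma lipschitzI:
  "g \<in> extensional V \<Longrightarrow> (\<And>x y. (x, y) \<in> E \<Longrightarrow> \<bar>g x - g y\<bar> \<le> int M) \<Longrightarrow> g \<in> lipschitz M"
  by (auto simp: lipschitz_def PiE_def)

lemma centredI_subset:
  assumes "g \<in> centred M" "h \<in> lipschitz M"
    and "\<And>w. w \<in> V \<Longrightarrow> g w \<in> {0..int M} \<Longrightarrow> h w \<in> {0..int M}"
  shows "h \<in> centred M"
proof -
  have "card {w \<in> V. h w \<notin> {0..int M}} \<le> card {w \<in> V. g w \<notin> {0..int M}}"
    using assms(3) by (intro card_mono) (auto simp: finV)
  with assms(1,2) show ?thesis unfolding centred_def by (auto intro: order_trans[rotated])
qed

text \<open>
  Lowering \<open>g b\<close> to 0 keeps \<open>g\<close> Lipschitz: a neighbour of \<open>b\<close> has value at most \<open>M\<close> by the definition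
  of \<open>flat\<close>, and at least \<open>1 - M\<close> because \<open>g b \<ge> 1\<close>.
\<close>

lemma lower_in_flat:
  assumes g: "g \<in> flat M A B" and b: "b \<in> boundary A" "b \<notin> B" "g b \<ge> 1"
  shows "g(b := 0) \<in> flat M A B"
proof -
  let ?h = "g(b := 0)"
  have gc: "g \<in> centred M" and gl: "g \<in> lipschitz M" using g by (auto simp: flat_def centred_def)
  have "b \<in> V" "b \<notin> A" using b boundary_subset by (auto simp: boundary_def)
  have nbr: "\<bar>g y\<bar> \<le> int M" if "(b, y) \<in> E" for y
  proof -
    have "\<bar>g b - g y\<bar> \<le> int M" using gl that by (rule lipschitzD)
    moreover have "g y \<le> int M" using g b that by (auto simp: flat_def)
    ultimately show ?thesis using b(3) by linarith
  qed
  have "\<bar>?h x - ?h y\<bar> \<le> int M" if "(x, y) \<in> E" for x y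
    using lipschitzD[OF gl that] nbr[of y] nbr[of x] that E_sym[OF that] by auto
  moreover have "?h \<in> V \<rightarrow>\<^sub>E UNIV" using gl \<open>b \<in> V\<close> by (auto simp: lipschitz_def)
  ultimately have "?h \<in> lipschitz M" unfolding lipschitz_def by blast
  then have "?h \<in> centred M" by (rule centredI_subset[OF gc]) auto
  then show ?thesis using g b(2) \<open>b \<notin> A\<close> unfolding flat_def by auto
qed

text \<open>
  Lowering \<open>b\<close> sends the functions with \<open>g b \<ge> 1\<close> to those with \<open>g b = 0\<close>, at most \<open>M\<close> to one, so the
  former are at most \<open>M / (M + 1)\<close> of the whole.
\<close>

lemma card_flat_insert:
  assumes fin: "finite (centred M)" and b: "b \<in> boundary A" "b \<notin> B"
  shows "real (card (flat M A (insert b B))) \<le> real M / (real M + 1) * real (card (flat M A B))"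
proof -
  let ?F = "flat M A B" and ?F' = "flat M A (insert b B)"
  let ?Z = "{g \<in> ?F. g b = 0}"
  have finF: "finite ?F" by (rule finite_subset[OF _ fin]) (auto simp: flat_def)
  have split: "?F = ?F' \<union> ?Z" "?F' \<inter> ?Z = {}"
  proof -
    have "g b = 0 \<or> g b \<ge> 1" if "g \<in> flat M A B" for g
    proof -
      have "g b \<ge> 0" using that b(1) by (auto simp: flat_def)
      then show ?thesis by linarith
    qed
    moreover have "?F' = {g \<in> ?F. g b \<ge> 1}" by (auto simp: flat_def)
    ultimately show "?F = ?F' \<union> ?Z" "?F' \<inter> ?Z = {}" by auto
  qed
  have "inj_on (\<lambda>g. (g(b := 0), g b)) ?F'"
  proof (rule inj_onI)
    fix g h assume "(g(b := 0), g b) = (h(b := 0), h b)"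
    then have "(g(b := 0))(b := g b) = (h(b := 0))(b := h b)" by simp
    then show "g = h" by simp
  qed
  moreover have "(\<lambda>g. (g(b := 0), g b)) ` ?F' \<subseteq> ?Z \<times> {1..int M}"
  proof (intro subsetI; elim imageE)
    fix z g assume z: "z = (g(b := 0), g b)" and g: "g \<in> ?F'"
    then have "g \<in> ?F" "g b \<ge> 1" "g b \<le> M" using b(1) by (auto simp: flat_def)
    then show "z \<in> ?Z \<times> {1..int M}" using lower_in_flat[OF _ b] z by auto
  qed
  ultimately have "card ?F' \<le> card (?Z \<times> {1..int M})"
    using finF by (intro card_inj_on_le) auto
  also have "\<dots> = M * card ?Z" by (simp add: card_cartesian_product)
  finally have "card ?F' \<le> M * card ?Z" .
  moreover have "card ?F = card ?F' + card ?Z"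
  proof -
    have "card ?F = card (?F' \<union> ?Z)" by (rule arg_cong[OF split(1)])
    also have "\<dots> = card ?F' + card ?Z"
    proof (rule card_Un_disjoint)
      show "finite ?F'" by (rule finite_subset[OF _ fin]) (auto simp: flat_def)
      show "finite ?Z" by (rule finite_subset[OF _ finF]) auto
    qed (rule split(2))
    finally show ?thesis .
  qed
  ultimately have "(M + 1) * card ?F' \<le> M * card ?F" by (simp add: algebra_simps)
  then have "(real M + 1) * card ?F' \<le> real M * card ?F"
    by (metis (mono_tags, opaque_lifting) of_nat_1 of_nat_add of_nat_le_iff of_nat_mult)
  then show ?thesis by (simp add: field_simps)
qed

lemma card_flat_le:
  assumes fin: "finite (centred M)"
  shows "real (card (flat M A (boundary A)))
    \<le> exp (- real (card (boundary A)) / (real M + 1)) * real (card (centred M))"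
proof -
  \<comment> \<open>The constraints \<open>g b \<ge> 1\<close> are imposed one boundary vertex at a time.\<close>
  have "finite B \<Longrightarrow> B \<subseteq> boundary A \<Longrightarrow>
    real (card (flat M A B)) \<le> (real M / (real M + 1)) ^ card B * real (card (centred M))" for B
  proof (induction B rule: finite_induct)
    case empty
    have "flat M A {} \<subseteq> centred M" by (auto simp: flat_def)
    then show ?case using fin by (auto intro: card_mono)
  next
    case (insert b B)
    then have "real (card (flat M A (insert b B))) \<le> real M / (real M + 1) * real (card (flat M A B))"
      by (intro card_flat_insert[OF fin]) auto
    also have "\<dots> \<le> real M / (real M + 1) * ((real M / (real M + 1)) ^ card B * real (card (centred M)))"
      using insert by (intro mult_left_mono) auto
    finally show ?case using insert by simp
  qed
  moreover have "finite (boundary A)" using boundary_subset finV by (rule finite_subset)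
  ultimately have "real (card (flat M A (boundary A)))
      \<le> (real M / (real M + 1)) ^ card (boundary A) * real (card (centred M))" by blast
  also have "\<dots> \<le> exp (- 1 / (real M + 1)) ^ card (boundary A) * real (card (centred M))"
  proof (intro mult_right_mono power_mono)
    have "real M / (real M + 1) = 1 + (- 1 / (real M + 1))" by (simp add: field_simps)
    then show "real M / (real M + 1) \<le> exp (- 1 / (real M + 1))" by (metis exp_ge_add_one_self)
  qed auto
  also have "exp (- 1 / (real M + 1)) ^ card (boundary A) = exp (- real (card (boundary A)) / (real M + 1))"
    by (simp flip: exp_of_nat_mult)
  finally show ?thesis .
qed

text \<open>
  A boundary vertex has a neighbour of value above \<open>M\<close>, hence a value of at least 1. Replacing \<open>g\<close> by 0
  on \<open>A\<close> is harmless because the edges leaving \<open>A\<close> end in the boundary, where \<open>g\<close> lies in \<open>{1..M}\<close>.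
\<close>

lemma zero_on_in_flat:
  assumes g: "g \<in> above M A" and A: "A \<subseteq> V"
  shows "(\<lambda>x. if x \<in> A then 0 else g x) \<in> flat M A (boundary A)" (is "?h \<in> _")
    and "\<And>b. b \<in> boundary A \<Longrightarrow> g b \<in> {1..int M}"
proof -
  have gc: "g \<in> centred M" and gl: "g \<in> lipschitz M" using g by (auto simp: above_def centred_def)
  show bd: "g b \<in> {1..int M}" if b: "b \<in> boundary A" for b
  proof -
    obtain x where x: "x \<in> A" "(x, b) \<in> E" using b by (auto simp: boundary_def Image_def)
    have "\<bar>g x - g b\<bar> \<le> int M" using gl x(2) by (rule lipschitzD)
    moreover have "g x > int M" using g x by (auto simp: above_def)
    moreover have "g b \<le> int M" using g b by (auto simp: above_def)
    ultimately show ?thesis by simp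
  qed
  have "\<bar>?h x - ?h y\<bar> \<le> int M" if "(x, y) \<in> E" for x y
  proof -
    have "y \<in> A \<or> y \<in> boundary A" if "x \<in> A" using that \<open>(x, y) \<in> E\<close> by (auto simp: boundary_def)
    moreover have "x \<in> A \<or> x \<in> boundary A" if "y \<in> A"
      using that E_sym[OF \<open>(x, y) \<in> E\<close>] by (auto simp: boundary_def)
    ultimately show ?thesis using lipschitzD[OF gl \<open>(x, y) \<in> E\<close>] bd[of x] bd[of y] by auto
  qed
  moreover have "?h \<in> V \<rightarrow>\<^sub>E UNIV" using gl A by (auto simp: lipschitz_def)
  ultimately have "?h \<in> lipschitz M" unfolding lipschitz_def by blast
  then have "?h \<in> centred M" by (rule centredI_subset[OF gc]) auto
  moreover have "?h b = g b" if "b \<in> boundary A" for b using that by (simp add: boundary_def)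
  ultimately show "?h \<in> flat M A (boundary A)"
    using g bd unfolding flat_def above_def by fastforce
qed

text \<open>
  A function is recovered from its values on \<open>A\<close> and its flattening. The values on \<open>A\<close> are grown from a
  vertex next to the boundary: \<open>M\<close> choices there, and \<open>4 M + 1 \<le> 5 M\<close> choices at each further vertex,
  since vertices at distance at most 2 differ by at most \<open>2 M\<close>.
\<close>

lemma card_above_le:
  assumes fin: "finite (centred M)" and M: "M \<ge> 1"
    and A: "A \<subseteq> V" "cut_connected within_two A" and ne: "boundary A \<noteq> {}"
  shows "real (card (above M A)) \<le> (5 * real M) ^ card A
     * (exp (- real (card (boundary A)) / (real M + 1)) * real (card (centred M)))"
proof -
  let ?r = "(\<lambda>g. restrict g A) ` above M A"
  let ?z = "\<lambda>g x. if x \<in> A then 0 else (g x :: int)"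
  have finA: "finite A" using A finV finite_subset by blast
  obtain a b where ab: "a \<in> A" "b \<in> boundary A" "(a, b) \<in> E" using ne by (auto simp: boundary_def)
  have cA: "card A > 0" using ab finA by (auto simp: card_gt_0_iff)
  have lip: "g \<in> lipschitz M" if "g \<in> above M A" for g
    using that by (auto simp: above_def centred_def)
  have "g a \<in> {int M + 1..2 * int M}" if "g \<in> above M A" for g
  proof -
    have "g b \<le> int M" "g a > int M" using that ab by (auto simp: above_def)
    then show ?thesis using lipschitzD[OF lip[OF that] ab(3)] by simp
  qed
  moreover have "\<bar>g p - g q\<bar> \<le> int (2 * M)" if g: "g \<in> above M A" and pq: "(p, q) \<in> within_two" for g p q
  proof (cases "(p, q) \<in> E")
    case True
    with lipschitzD[OF lip[OF g]] have "\<bar>g p - g q\<bar> \<le> int M" by blast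
    then show ?thesis by simp
  next
    case False
    then obtain s where "(p, s) \<in> E" "(s, q) \<in> E" using pq by (auto simp: within_two_def)
    with lipschitzD[OF lip[OF g]] have "\<bar>g p - g s\<bar> \<le> int M" "\<bar>g s - g q\<bar> \<le> int M"
      by blast+
    then show ?thesis by simp
  qed
  ultimately have r0: "finite ?r \<and> card ?r \<le> card {int M + 1..2 * int M} * (2 * (2 * M) + 1) ^ (card A - 1)"
    by (intro card_lipschitz_on_cut_connected_le[OF finA A(2) ab(1)]) auto
  have "card ?r \<le> card {int M + 1..2 * int M} * (2 * (2 * M) + 1) ^ (card A - 1)"
    using r0 by (rule conjunct2)
  also have "\<dots> \<le> (5 * M) * (5 * M) ^ (card A - 1)"
    using M by (intro mult_mono power_mono) auto
  also have "\<dots> = (5 * M) ^ card A" using cA by (metis power_Suc Suc_pred')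
  finally have r: "card ?r \<le> (5 * M) ^ card A" .
  have finr: "finite ?r" using r0 by (rule conjunct1)
  have finF: "finite (flat M A (boundary A))" by (rule finite_subset[OF _ fin]) (auto simp: flat_def)
  have "inj_on (\<lambda>g. (restrict g A, ?z g)) (above M A)"
  proof (rule inj_onI)
    fix g h assume eq: "(restrict g A, ?z g) = (restrict h A, ?z h)"
    show "g = h"
    proof
      fix x
      have "restrict g A = restrict h A" "?z g = ?z h" using eq by auto
      from fun_cong[OF this(1)] fun_cong[OF this(2)]
      have "restrict g A x = restrict h A x" "?z g x = ?z h x" .
      then show "g x = h x" by (cases "x \<in> A") auto
    qed
  qed
  moreover have "(\<lambda>g. (restrict g A, ?z g)) ` above M A \<subseteq> ?r \<times> flat M A (boundary A)"
    using zero_on_in_flat(1)[OF _ A(1)] by auto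
  ultimately have "card (above M A) \<le> card (?r \<times> flat M A (boundary A))"
    using finr finF by (intro card_inj_on_le finite_cartesian_product)
  also have "\<dots> \<le> (5 * M) ^ card A * card (flat M A (boundary A))"
    unfolding card_cartesian_product using r by (rule mult_right_mono) simp
  finally have "real (card (above M A)) \<le> (5 * real M) ^ card A * real (card (flat M A (boundary A)))"
    by (metis (mono_tags, opaque_lifting) of_nat_le_iff of_nat_mult of_nat_numeral of_nat_power)
  also have "\<dots> \<le> (5 * real M) ^ card A
     * (exp (- real (card (boundary A)) / (real M + 1)) * real (card (centred M)))"
    by (intro mult_left_mono card_flat_le[OF fin]) auto
  finally show ?thesis .
qed

definition ball :: "'a \<Rightarrow> nat \<Rightarrow> 'a set" where
  "ball v t = (\<Union>s\<le>t. (E ^^ s) `` {v})"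

lemma relpow_lipschitz:
  assumes "g \<in> lipschitz M"
  shows "(x, y) \<in> E ^^ s \<Longrightarrow> \<bar>g x - g y\<bar> \<le> int s * int M"
proof (induction s arbitrary: y)
  case (Suc s)
  then obtain z where "(x, z) \<in> E ^^ s" "(z, y) \<in> E" by auto
  with Suc.IH[of z] lipschitzD[OF assms, of z y] have "\<bar>g x - g y\<bar> \<le> int s * int M + int M" by linarith
  then show ?case by (simp add: algebra_simps)
qed simp

text \<open>
  \<open>A\<close> is the component of \<open>v\<close> in \<open>{g > M}\<close>. A vertex at distance \<open>s < t\<close> from \<open>v\<close> has a value greater than
  \<open>(t - s) M \<ge> M\<close>, so it is in \<open>A\<close>; the vertices at distance \<open>t\<close> are then in \<open>A\<close> or next to it.
\<close>

lemma high_component: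
  assumes g: "g \<in> centred M" and v: "v \<in> V" "g v > int t * int M" and t: "t \<ge> 1"
  obtains A where "A \<subseteq> V" "v \<in> A" "cut_connected within_two A"
    "real (card A) \<le> 2 * lam * real (card V) / real d" "g \<in> above M A"
    "ball v t \<subseteq> A \<union> boundary A"
proof
  define U where "U = {x \<in> V. g x > int M}"
  define A where "A = (within_two \<inter> U \<times> U)\<^sup>* `` {v}"
  have gl: "g \<in> lipschitz M" using g by (auto simp: centred_def)
  have "1 * int M \<le> int t * int M" using t by (intro mult_right_mono) auto
  then have vU: "v \<in> U" using v by (auto simp: U_def)
  show vA: "v \<in> A" by (auto simp: A_def)
  show "cut_connected within_two A" unfolding A_def by (rule cut_connected_component[OF sym_within_two vU])
  have step: "y \<in> A" if "x \<in> A" "(x, y) \<in> within_two" "x \<in> U" "y \<in> U" for x y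
    using that by (auto simp: A_def intro: rtrancl_into_rtrancl)
  have AU: "A \<subseteq> U"
  proof
    fix x assume "x \<in> A"
    then have "(v, x) \<in> (within_two \<inter> U \<times> U)\<^sup>*" by (simp add: A_def)
    then show "x \<in> U" by (induction rule: rtrancl_induct) (use vU in auto)
  qed
  then show AV: "A \<subseteq> V" by (auto simp: U_def)
  have "card A \<le> card {w \<in> V. g w \<notin> {0..int M}}"
    by (rule card_mono) (use AU finV in \<open>auto simp: U_def\<close>)
  then show "real (card A) \<le> 2 * lam * real (card V) / real d"
    using g unfolding centred_def by (auto intro: order_trans[rotated])
  have escape: "y \<in> A" if "x \<in> A" "(x, y) \<in> within_two" "g y > int M" for x y
  proof -
    have "y \<in> V" using that(2) EV by (auto simp: within_two_def)
    then show ?thesis using step[OF that(1,2)] that AU by (auto simp: U_def)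
  qed
  show "g \<in> above M A"
  proof -
    have "g b \<le> int M" if b: "b \<in> boundary A" for b
    proof (rule ccontr)
      assume "\<not> g b \<le> int M"
      moreover obtain a where "a \<in> A" "(a, b) \<in> E" using b by (auto simp: boundary_def Image_def)
      ultimately have "b \<in> A" using escape[of a b] by (auto simp: within_two_def)
      then show False using b by (simp add: boundary_def)
    qed
    moreover have "g y \<le> int M" if b: "b \<in> boundary A" and y: "(b, y) \<in> E" "y \<notin> A" for b y
    proof (rule ccontr)
      assume "\<not> g y \<le> int M"
      moreover obtain a where "a \<in> A" "(a, b) \<in> E" using b by (auto simp: boundary_def Image_def)
      ultimately have "y \<in> A" using escape[of a y] y(1) by (auto simp: within_two_def)
      then show False using y by simp
    qed
    moreover have "g x > int M" if "x \<in> A" for x using that AU by (auto simp: U_def)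
    ultimately show ?thesis using g by (simp add: above_def)
  qed
  have inA: "(v, y) \<in> E ^^ s \<Longrightarrow> s < t \<Longrightarrow> y \<in> A" for s y
  proof (induction s arbitrary: y)
    case 0
    then show ?case using vA by simp
  next
    case (Suc s)
    then obtain z where z: "(v, z) \<in> E ^^ s" "(z, y) \<in> E" by auto
    then have "z \<in> A" using Suc by simp
    have "\<bar>g v - g y\<bar> \<le> int (Suc s) * int M" using relpow_lipschitz[OF gl Suc.prems(1)] .
    moreover have "int (Suc s) * int M + int M \<le> int t * int M"
    proof -
      have "(int (Suc s) + 1) * int M \<le> int t * int M"
        using Suc.prems(2) by (intro mult_right_mono) auto
      then show ?thesis by (simp add: algebra_simps)
    qed
    ultimately have "g y > int M" using v(2) by linarith
    then show ?case using escape[OF \<open>z \<in> A\<close>] z(2) by (auto simp: within_two_def)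
  qed
  show "ball v t \<subseteq> A \<union> boundary A"
  proof
    fix y assume "y \<in> ball v t"
    then obtain s where s: "s \<le> t" "(v, y) \<in> E ^^ s" by (auto simp: ball_def)
    show "y \<in> A \<union> boundary A"
    proof (cases s)
      case 0
      then show ?thesis using s vA by simp
    next
      case (Suc s')
      then obtain z where z: "(v, z) \<in> E ^^ s'" "(z, y) \<in> E" using s(2) by auto
      then have "z \<in> A" using inA[OF z(1)] s(1) Suc by simp
      then show ?thesis using z(2) by (auto simp: boundary_def)
    qed
  qed
qed

end

section \<open>Summation over the components\<close>

lemma card_int_set_le:
  fixes C :: "int set"
  assumes "\<And>c c'. c \<in> C \<Longrightarrow> c' \<in> C \<Longrightarrow> c' \<le> c + int M"
  shows "finite C \<and> card C \<le> M + 1"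
proof (cases "C = {}")
  case False
  then obtain c where c: "c \<in> C" by blast
  have "C \<subseteq> {c - int M..c + int M}" using assms c by fastforce
  then have fin: "finite C" by (rule finite_subset) simp
  then have "C \<subseteq> {Min C..Min C + int M}" using assms Min_in[OF fin False] by auto
  then have "card C \<le> card {Min C..Min C + int M}" by (rule card_mono[rotated]) simp
  then show ?thesis using fin by simp
qed simp

locale good_regular_expander = regular_expander +
  fixes M :: nat and L :: real
  assumes M: "M \<ge> 1"
    and L_def: "L = ln (9 * real M * (real d)\<^sup>2)"
    and good: "lam \<le> real d / (32 * ((real M + 1) * L))"
begin

lemma exp_L: "exp L = 9 * real M * (real d)\<^sup>2"
  using M d_pos by (simp add: L_def)

lemma nine_M_le_exp_L: "9 * real M \<le> exp L" and two_d_sq_le_exp_L: "2 * (real d)\<^sup>2 \<le> exp L"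
proof -
  have "1 \<le> (real d)\<^sup>2" using d_pos by simp
  then have "9 * real M * 1 \<le> 9 * real M * (real d)\<^sup>2" by (intro mult_left_mono) auto
  then show "9 * real M \<le> exp L" by (simp add: exp_L)
  have "2 * (real d)\<^sup>2 \<le> (9 * real M) * (real d)\<^sup>2" using M by (intro mult_right_mono) auto
  then show "2 * (real d)\<^sup>2 \<le> exp L" by (simp add: exp_L)
qed

lemma L_ge_2: "L \<ge> 2"
proof -
  have "exp (2 :: real) = exp 1 * exp 1" by (simp flip: exp_add)
  also have "\<dots> \<le> 3 * 3" using exp_le by (intro mult_mono) auto
  also have "\<dots> \<le> exp L" using nine_M_le_exp_L M by linarith
  finally show ?thesis by simp
qed

lemma M_plus_1_L_ge_4: "(real M + 1) * L \<ge> 4"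
proof -
  have "2 * 2 \<le> (real M + 1) * L" using M L_ge_2 by (intro mult_mono) auto
  then show ?thesis by simp
qed

text \<open>
  With \<open>a = |A|\<close>, \<open>m = |A \<union> D|\<close> and \<open>K = M + 1\<close>, the exponent is at most \<open>L a - (m - a) / K\<close>. Of \<open>m / K\<close>,
  one fifth yields \<open>\<beta> / (5 K)\<close>, and the remaining four fifths are at least \<open>11.2 L a\<close> by
  \<open>vertex_expansion\<close>, which leaves at least \<open>9 L a\<close> after paying for \<open>L a + a / K\<close>.
\<close>

lemma card_above_le_exp:
  assumes fin: "finite (centred M)"
    and A: "A \<subseteq> V" "cut_connected within_two A" "A \<noteq> {}"
      "real (card A) \<le> 2 * lam * real (card V) / real d"
    and \<beta>: "\<beta> \<le> real (card (A \<union> boundary A))"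
  shows "real (card (above M A))
    \<le> exp (- \<beta> / (5 * (real M + 1))) * real (card (centred M)) * exp (- 9 * L) ^ card A"
proof -
  define a m K where "a = real (card A)" and "m = real (card (A \<union> boundary A))" and "K = real M + 1"
  have finA: "finite A" using A(1) finV finite_subset by blast
  have finB: "finite (boundary A)" using boundary_subset finV finite_subset by blast
  have K: "K \<ge> 2" using M by (simp add: K_def)
  have a: "a \<ge> 1" using A(3) finA by (simp add: a_def Suc_le_eq card_gt_0_iff)
  have mb: "m = a + real (card (boundary A))"
  proof -
    have "A \<inter> boundary A = {}" by (auto simp: boundary_def)
    then show ?thesis using card_Un_disjoint[OF finA finB] by (simp add: m_def a_def)
  qed
  have m: "m \<ge> 14 * (K * L) * a"
    using vertex_expansion[OF M_plus_1_L_ge_4 good A(1,4)] by (simp add: a_def m_def K_def)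
  have "4 * a \<le> (K * L) * a" using M_plus_1_L_ge_4 a by (intro mult_right_mono) (auto simp: K_def)
  with m a have "m > a" by linarith
  then have ne: "boundary A \<noteq> {}" using mb by auto
  have "real (card (above M A)) \<le> (5 * real M) ^ card A
     * (exp (- real (card (boundary A)) / K) * real (card (centred M)))"
    unfolding K_def by (rule card_above_le[OF fin M A(1,2) ne])
  also have "\<dots> \<le> exp L ^ card A * (exp (- real (card (boundary A)) / K) * real (card (centred M)))"
    using nine_M_le_exp_L by (intro mult_right_mono power_mono) auto
  also have "\<dots> = exp (L * a - (m - a) / K) * real (card (centred M))"
  proof -
    have "exp L ^ card A * exp (- real (card (boundary A)) / K) = exp (L * a - (m - a) / K)"
      using mb by (simp add: a_def mult.commute flip: exp_of_nat_mult exp_add)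
    then show ?thesis by (simp flip: mult.assoc)
  qed
  also have "\<dots> \<le> exp (- \<beta> / (5 * K) + - 9 * L * a) * real (card (centred M))"
  proof (intro mult_right_mono)
    have "\<beta> / (5 * K) \<le> m / (5 * K)" using \<beta> K by (simp add: m_def divide_right_mono)
    moreover have "14 * (L * a) \<le> m / K" using m K by (simp add: field_simps)
    moreover have "a / K \<le> a / 2" using K a by (intro divide_left_mono) auto
    moreover have "2 * a \<le> L * a" using L_ge_2 a by (intro mult_right_mono) auto
    moreover note a
    moreover have "m / K = 5 * (m / (5 * K))" by simp
    moreover have "(m - a) / K = m / K - a / K" by (rule diff_divide_distrib)
    ultimately have "L * a - (m - a) / K + 9 * (L * a) + \<beta> / (5 * K) \<le> 0" by linarith
    then show "exp (L * a - (m - a) / K) \<le> exp (- \<beta> / (5 * K) + - 9 * L * a)" by simp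
  qed simp
  also have "\<dots> = exp (- \<beta> / (5 * K)) * real (card (centred M)) * exp (- 9 * L) ^ card A"
    unfolding exp_add by (simp add: a_def mult.commute mult.left_commute flip: exp_of_nat_mult)
  finally show ?thesis by (simp add: K_def)
qed

text \<open>
  There are at most \<open>(2 d\<^sup>2) ^ (2 j) \<le> exp (2 L j)\<close> connected sets of size \<open>j + 1\<close> through \<open>v\<close>, so the sum
  is dominated by a geometric series with first term \<open>exp (- 9 L)\<close> and ratio \<open>exp (- 7 L) \<le> 1/2\<close>.
\<close>

lemma sum_connected_sets_le:
  assumes "finite \<A>" "\<And>A. A \<in> \<A> \<Longrightarrow> finite A \<and> cut_connected within_two A \<and> v \<in> A"
  shows "(\<Sum>A\<in>\<A>. exp (- 9 * L) ^ card A) \<le> 1 / (2 * (real M + 1))"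
proof -
  let ?C = "\<lambda>a. {A. finite A \<and> cut_connected within_two A \<and> v \<in> A \<and> card A = a}"
  obtain N where N: "\<And>A. A \<in> \<A> \<Longrightarrow> card A \<le> N"
    using finite_imageI[OF assms(1), of card] by (metis finite_nat_set_iff_bounded_le image_eqI)
  have C: "finite (?C (Suc j)) \<and> card (?C (Suc j)) \<le> (2 * d\<^sup>2) ^ (2 * j)" for j
    using card_cut_connected_le[OF finite_within_two card_within_two_le sym_within_two, of "Suc j" v] by simp
  have "\<A> \<subseteq> (\<Union>j<N. ?C (Suc j))"
  proof
    fix A assume A: "A \<in> \<A>"
    then have "card A > 0" "card A \<le> N" using assms(2)[OF A] N[OF A] by (auto simp: card_gt_0_iff)
    then show "A \<in> (\<Union>j<N. ?C (Suc j))"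
      using assms(2)[OF A] by (intro UN_I[of "card A - 1"]) auto
  qed
  then have "(\<Sum>A\<in>\<A>. exp (- 9 * L) ^ card A)
      \<le> (\<Sum>A\<in>(\<Union>j<N. ?C (Suc j)). exp (- 9 * L) ^ card A)"
    using C by (intro sum_mono2) auto
  also have "\<dots> = (\<Sum>j<N. \<Sum>A\<in>?C (Suc j). exp (- 9 * L) ^ card A)"
    using C by (intro sum.UNION_disjoint) auto
  also have "\<dots> \<le> (\<Sum>j<N. exp (- 9 * L) * (1 / 2) ^ j)"
  proof (rule sum_mono)
    fix j
    have "(\<Sum>A\<in>?C (Suc j). exp (- 9 * L) ^ card A) = real (card (?C (Suc j))) * exp (- 9 * L) ^ Suc j"
      by simp
    also have "\<dots> \<le> real ((2 * d\<^sup>2) ^ (2 * j)) * exp (- 9 * L) ^ Suc j"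
      using C[of j] by (intro mult_right_mono of_nat_mono) auto
    also have "real ((2 * d\<^sup>2) ^ (2 * j)) = (2 * (real d)\<^sup>2) ^ (2 * j)" by simp
    also have "(2 * (real d)\<^sup>2) ^ (2 * j) * exp (- 9 * L) ^ Suc j
        \<le> exp L ^ (2 * j) * exp (- 9 * L) ^ Suc j"
      using two_d_sq_le_exp_L by (intro mult_right_mono power_mono) auto
    also have "\<dots> = exp (- 9 * L) * (exp L ^ 2 * exp (- 9 * L)) ^ j"
      by (simp only: power_mult power_mult_distrib power_Suc mult_ac flip: power_mult)
    also have "exp L ^ 2 * exp (- 9 * L) = exp (- 7 * L)"
      by (simp add: power2_eq_square flip: exp_add)
    also have "exp (- 9 * L) * exp (- 7 * L) ^ j \<le> exp (- 9 * L) * (1 / 2) ^ j"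
    proof (intro mult_left_mono power_mono)
      have "2 \<le> exp (7 * L)" using exp_ge_add_one_self[of "7 * L"] L_ge_2 by linarith
      then show "exp (- 7 * L) \<le> 1 / 2" by (simp add: exp_minus field_simps)
    qed auto
    finally show "(\<Sum>A\<in>?C (Suc j). exp (- 9 * L) ^ card A) \<le> exp (- 9 * L) * (1 / 2) ^ j" .
  qed
  also have "\<dots> = exp (- 9 * L) * (2 * (1 - (1 / 2) ^ N))"
    by (simp add: sum_gp_strict flip: sum_distrib_left)
  also have "\<dots> \<le> exp (- 9 * L) * 2" by (intro mult_left_mono) auto
  also have "\<dots> \<le> exp (- L) * 2" using L_ge_2 by simp
  also have "\<dots> \<le> 1 / (2 * (real M + 1))"
  proof -
    have "real M \<ge> 1" using M by simp
    with nine_M_le_exp_L have "4 * real M + 4 \<le> exp L" by linarith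
    then show ?thesis using M by (simp add: exp_minus field_simps)
  qed
  finally show ?thesis .
qed

lemma card_high_le:
  assumes fin: "finite (centred M)" and v: "v \<in> V" and t: "t \<ge> 1"
  shows "real (card {g \<in> centred M. g v > int t * int M})
    \<le> exp (- real (card (ball v t)) / (5 * (real M + 1))) * real (card (centred M))
       / (2 * (real M + 1))"
proof -
  define \<A> where "\<A> = {A \<in> Pow V. v \<in> A \<and> cut_connected within_two A \<and>
      real (card A) \<le> 2 * lam * real (card V) / real d \<and> card (ball v t) \<le> card (A \<union> boundary A)}"
  let ?c = "exp (- real (card (ball v t)) / (5 * (real M + 1))) * real (card (centred M))"
  have fA: "finite \<A>" using finV by (simp add: \<A>_def)
  have A: "finite A \<and> cut_connected within_two A \<and> v \<in> A" if "A \<in> \<A>" for A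
    using that finV finite_subset by (auto simp: \<A>_def)
  have sub: "{g \<in> centred M. g v > int t * int M} \<subseteq> (\<Union>A\<in>\<A>. above M A)"
  proof
    fix g assume "g \<in> {g \<in> centred M. g v > int t * int M}"
    then obtain A where A: "A \<subseteq> V" "v \<in> A" "cut_connected within_two A"
      "real (card A) \<le> 2 * lam * real (card V) / real d" "g \<in> above M A"
      "ball v t \<subseteq> A \<union> boundary A" using high_component[OF _ v _ t] by blast
    moreover have "finite (A \<union> boundary A)" using A(1) boundary_subset finV finite_subset by blast
    ultimately have "A \<in> \<A>" by (simp add: \<A>_def card_mono)
    then show "g \<in> (\<Union>A\<in>\<A>. above M A)" using A by blast
  qed
  have finab: "finite (above M A)" for A by (rule finite_subset[OF _ fin]) (auto simp: above_def)
  have "card {g \<in> centred M. g v > int t * int M} \<le> card (\<Union>A\<in>\<A>. above M A)"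
    by (intro card_mono[OF _ sub] finite_UN_I fA finab)
  also have "\<dots> \<le> (\<Sum>A\<in>\<A>. card (above M A))" by (rule card_UN_le[OF fA])
  finally have "real (card {g \<in> centred M. g v > int t * int M}) \<le> (\<Sum>A\<in>\<A>. real (card (above M A)))"
    by (simp flip: of_nat_sum)
  also have "\<dots> \<le> (\<Sum>A\<in>\<A>. ?c * exp (- 9 * L) ^ card A)"
    by (intro sum_mono card_above_le_exp fin) (auto simp: \<A>_def)
  also have "\<dots> = ?c * (\<Sum>A\<in>\<A>. exp (- 9 * L) ^ card A)" by (simp add: sum_distrib_left)
  also have "\<dots> \<le> ?c * (1 / (2 * (real M + 1)))"
    by (intro mult_left_mono sum_connected_sets_le[OF fA A]) auto
  finally show ?thesis by simp
qed

definition rooted :: "'a \<Rightarrow> ('a \<Rightarrow> int) set" where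
  "rooted v0 = {f \<in> lipschitz M. f v0 = 0}"

text \<open>
  A vertex at distance \<open>s\<close> from the root takes values in \<open>{- s M..s M}\<close>; connectedness provides such
  an \<open>s\<close> for every vertex.
\<close>

lemma finite_rooted:
  assumes conn: "\<And>x. x \<in> V \<Longrightarrow> (v0, x) \<in> E\<^sup>*"
  shows "finite (rooted v0)"
proof -
  have "\<exists>s. (v0, x) \<in> E ^^ s" if "x \<in> V" for x using conn[OF that] by (simp add: rtrancl_power)
  then obtain s where s: "\<And>x. x \<in> V \<Longrightarrow> (v0, x) \<in> E ^^ s x" by metis
  have "rooted v0 \<subseteq> (\<Pi>\<^sub>E x\<in>V. {- (int (s x) * int M)..int (s x) * int M})"
  proof
    fix f assume f: "f \<in> rooted v0"
    then have fl: "f \<in> lipschitz M" and f0: "f v0 = 0" by (auto simp: rooted_def)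
    have "f x \<in> {- (int (s x) * int M)..int (s x) * int M}" if "x \<in> V" for x
      using relpow_lipschitz[OF fl s[OF that]] f0 by auto
    moreover have "f \<in> V \<rightarrow>\<^sub>E UNIV" using fl by (simp add: lipschitz_def)
    ultimately show "f \<in> (\<Pi>\<^sub>E x\<in>V. {- (int (s x) * int M)..int (s x) * int M})" by (simp add: PiE_iff)
  qed
  then show ?thesis by (rule finite_subset) (simp add: finite_PiE finV)
qed

lemma translate_lipschitz:
  assumes "g \<in> lipschitz M" shows "(\<lambda>x\<in>V. g x - c) \<in> lipschitz M"
proof -
  have "\<bar>(\<lambda>x\<in>V. g x - c) x - (\<lambda>x\<in>V. g x - c) y\<bar> \<le> int M" if "(x, y) \<in> E" for x y
    using lipschitzD[OF assms that] E_in_V[OF that] by simp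
  then show ?thesis by (intro lipschitzI) simp_all
qed

lemma reflect_lipschitz:
  assumes "g \<in> lipschitz M" shows "(\<lambda>x\<in>V. c - g x) \<in> lipschitz M"
proof -
  have "\<bar>(\<lambda>x\<in>V. c - g x) x - (\<lambda>x\<in>V. c - g x) y\<bar> \<le> int M" if "(x, y) \<in> E" for x y
    using lipschitzD[OF assms that] E_in_V[OF that] by simp
  then show ?thesis by (intro lipschitzI) simp_all
qed

text \<open>
  For \<open>c > M\<close> no vertex has both values in \<open>{0..M}\<close>, so the two exceptional sets cover \<open>V\<close>; but together
  they have at most \<open>4 \<lambda> n / d \<le> n / 32\<close> vertices.
\<close>

lemma translates_centred_close:
  assumes V: "V \<noteq> {}" and g: "g \<in> centred M" and h: "h \<in> centred M"
    and diff: "\<And>x. x \<in> V \<Longrightarrow> h x = g x + c"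
  shows "c \<le> int M"
proof (rule ccontr)
  assume c: "\<not> c \<le> int M"
  let ?bad = "\<lambda>g. {w \<in> V. g w \<notin> {0..int M}}"
  have "V \<subseteq> ?bad g \<union> ?bad h" using diff c by force
  then have "card V \<le> card (?bad g \<union> ?bad h)" using finV by (intro card_mono) auto
  also have "\<dots> \<le> card (?bad g) + card (?bad h)" by (rule card_Un_le)
  finally have "real (card V) \<le> real (card (?bad g)) + real (card (?bad h))" by linarith
  also have "\<dots> \<le> 2 * lam * real (card V) / real d + 2 * lam * real (card V) / real d"
    using g h by (intro add_mono) (auto simp: centred_def)
  also have "\<dots> = 4 * (lam / real d) * real (card V)" by simp
  also have "\<dots> \<le> 4 * (1 / 128) * real (card V)"
  proof (intro mult_right_mono mult_left_mono)
    have "lam \<le> real d / (32 * ((real M + 1) * L))" by (rule good)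
    also have "\<dots> \<le> real d / (32 * 4)" using M_plus_1_L_ge_4 by (intro divide_left_mono mult_left_mono) auto
    finally show "lam / real d \<le> 1 / 128" using d_pos by (simp add: field_simps)
  qed auto
  finally show False using V finV by (simp add: card_gt_0_iff)
qed

text \<open>
  Translating the value at \<open>v0\<close> to 0 maps the centred functions to the rooted ones. A fibre consists
  of translates of one function, whose shifts form a set of integers of diameter at most \<open>M\<close>.
\<close>

lemma card_centred_le:
  assumes v0: "v0 \<in> V" and fin: "finite (rooted v0)"
  shows "finite (centred M) \<and> card (centred M) \<le> (M + 1) * card (rooted v0)"
proof -
  let ?n = "\<lambda>g. \<lambda>x\<in>V. g x - g v0"
  let ?fib = "\<lambda>f. {g \<in> centred M. ?n g = f}"
  have ext: "g x = undefined" if "g \<in> centred M" "x \<notin> V" for g x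
    using that by (auto simp: centred_def lipschitz_def)
  have fib: "finite (?fib f) \<and> card (?fib f) \<le> M + 1" for f
  proof -
    have val: "g x = f x + g v0" if "g \<in> ?fib f" "x \<in> V" for g x using that by auto
    have inj: "inj_on (\<lambda>g. g v0) (?fib f)"
    proof (rule inj_onI)
      fix g h assume gh: "g \<in> ?fib f" "h \<in> ?fib f" "g v0 = h v0"
      show "g = h"
      proof
        fix x show "g x = h x"
          using val[OF gh(1), of x] val[OF gh(2), of x] gh ext[of g x] ext[of h x] by (cases "x \<in> V") auto
      qed
    qed
    have "finite ((\<lambda>g. g v0) ` ?fib f) \<and> card ((\<lambda>g. g v0) ` ?fib f) \<le> M + 1"
    proof (rule card_int_set_le)
      fix c c' assume "c \<in> (\<lambda>g. g v0) ` ?fib f" "c' \<in> (\<lambda>g. g v0) ` ?fib f"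
      then obtain g h where gh: "g \<in> ?fib f" "h \<in> ?fib f" "c = g v0" "c' = h v0" by blast
      have "c' - c \<le> int M"
      proof (rule translates_centred_close)
        show "h x = g x + (c' - c)" if "x \<in> V" for x
          using val[OF gh(1) that] val[OF gh(2) that] gh by simp
      qed (use gh v0 in auto)
      then show "c' \<le> c + int M" by simp
    qed
    then show ?thesis using finite_image_iff[OF inj] card_image[OF inj] by simp
  qed
  have eq: "centred M = (\<Union>f\<in>rooted v0. ?fib f)"
  proof
    show "centred M \<subseteq> (\<Union>f\<in>rooted v0. ?fib f)"
    proof
      fix g assume g: "g \<in> centred M"
      then have "?n g \<in> rooted v0"
        using translate_lipschitz[of g "g v0"] v0 by (auto simp: rooted_def centred_def)
      then show "g \<in> (\<Union>f\<in>rooted v0. ?fib f)" using g by blast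
    qed
  qed blast
  have "card (\<Union>f\<in>rooted v0. ?fib f) \<le> (\<Sum>f\<in>rooted v0. card (?fib f))" by (rule card_UN_le[OF fin])
  also have "\<dots> \<le> (\<Sum>f\<in>rooted v0. M + 1)" by (intro sum_mono conjunct2[OF fib])
  finally have "card (centred M) \<le> (M + 1) * card (rooted v0)"
    using eq by (simp add: mult.commute)
  moreover have "finite (\<Union>f\<in>rooted v0. ?fib f)" by (intro finite_UN_I fin conjunct1[OF fib])
  ultimately show ?thesis using eq by simp
qed

text \<open>
  Subtracting \<open>k\<close> makes \<open>f\<close> centred and loses nothing, since \<open>f v0 = 0\<close> gives \<open>k\<close> back. The functions
  that are low at \<open>v\<close> are turned into functions that are high at \<open>v\<close> by \<open>g \<mapsto> M - g\<close>.
\<close>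

lemma card_far_le:
  assumes v0: "v0 \<in> V" and conn: "\<And>x. x \<in> V \<Longrightarrow> (v0, x) \<in> E\<^sup>*" and v: "v \<in> V" and t: "t \<ge> 1"
    and B: "B \<subseteq> rooted v0"
    and far: "\<And>f. f \<in> B \<Longrightarrow> \<exists>k.
        real (card {w \<in> V. f w \<notin> {k..k + int M}}) \<le> 2 * lam * real (card V) / real d \<and>
        (f v > k + int t * int M \<or> f v < k + int M - int t * int M)"
  shows "real (card B) \<le> exp (- real (card (ball v t)) / (5 * (real M + 1))) * real (card (rooted v0))"
proof -
  let ?e = "exp (- real (card (ball v t)) / (5 * (real M + 1)))"
  have finr: "finite (rooted v0)" by (rule finite_rooted[OF conn])
  have cen: "finite (centred M)" "card (centred M) \<le> (M + 1) * card (rooted v0)"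
    using card_centred_le[OF v0 finr] by auto
  let ?H = "{g \<in> centred M. g v > int t * int M}"
  let ?D = "{g \<in> centred M. g v < int M - int t * int M}"
  have "\<forall>f\<in>B. \<exists>k.
        real (card {w \<in> V. f w \<notin> {k..k + int M}}) \<le> 2 * lam * real (card V) / real d \<and>
        (f v > k + int t * int M \<or> f v < k + int M - int t * int M)"
    by (rule ballI) (rule far)
  from bchoice[OF this] obtain k where "\<forall>f\<in>B.
        real (card {w \<in> V. f w \<notin> {k f..k f + int M}}) \<le> 2 * lam * real (card V) / real d \<and>
        (f v > k f + int t * int M \<or> f v < k f + int M - int t * int M)" ..
  note k = bspec[OF this]
  let ?s = "\<lambda>f. \<lambda>x\<in>V. f x - k f"
  have "?s f \<in> ?H \<union> ?D" if "f \<in> B" for f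
  proof -
    have "{w \<in> V. ?s f w \<notin> {0..int M}} = {w \<in> V. f w \<notin> {k f..k f + int M}}" by auto
    then have "?s f \<in> centred M"
      using k[OF that] that B translate_lipschitz[of f "k f"] by (auto simp: centred_def rooted_def)
    then show ?thesis using k[OF that] v by auto
  qed
  then have img: "?s ` B \<subseteq> ?H \<union> ?D" by (rule image_subsetI)
  have inj: "inj_on ?s B"
  proof (rule inj_onI)
    fix f g assume fg: "f \<in> B" "g \<in> B" "?s f = ?s g"
    have eq: "f x - k f = g x - k g" if "x \<in> V" for x using fun_cong[OF fg(3), of x] that by simp
    have "f v0 = 0" "g v0 = 0" using fg B by (auto simp: rooted_def)
    then have "k f = k g" using eq[OF v0] by simp
    have "f x = undefined" "g x = undefined" if "x \<notin> V" for x
      using fg B that by (auto simp: rooted_def lipschitz_def)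
    then show "f = g" using eq \<open>k f = k g\<close> by (intro ext) (metis add.commute diff_add_cancel)
  qed
  have "finite (?H \<union> ?D)" using cen by simp
  with inj img have "card B \<le> card (?H \<union> ?D)" by (rule card_inj_on_le)
  also have "\<dots> \<le> card ?H + card ?D" by (rule card_Un_le)
  also have "card ?D \<le> card ?H"
  proof (rule card_inj_on_le)
    let ?m = "\<lambda>g. \<lambda>x\<in>V. int M - g x"
    show "inj_on ?m ?D"
    proof (rule inj_onI)
      fix f g assume fg: "f \<in> ?D" "g \<in> ?D" "?m f = ?m g"
      have eq: "f x = g x" if "x \<in> V" for x using fun_cong[OF fg(3), of x] that by simp
      have "f x = undefined" "g x = undefined" if "x \<notin> V" for x
        using fg that by (auto simp: centred_def lipschitz_def)
      then show "f = g" using eq by (intro ext) metis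
    qed
    show "?m ` ?D \<subseteq> ?H"
    proof (intro subsetI; elim imageE)
      fix h g assume h: "h = ?m g" and g: "g \<in> ?D"
      have gc: "g \<in> centred M" and gv: "g v < int M - int t * int M" using g by simp_all
      then have "?m g \<in> lipschitz M" by (intro reflect_lipschitz) (simp add: centred_def)
      with gc have "?m g \<in> centred M" by (rule centredI_subset) simp
      moreover have "?m g v > int t * int M" using gv v by simp
      ultimately show "h \<in> ?H" using h by simp
    qed
  qed (use cen in auto)
  finally have "real (card B) \<le> 2 * real (card ?H)" by simp
  also have "\<dots> \<le> 2 * (?e * real (card (centred M)) / (2 * (real M + 1)))"
    by (intro mult_left_mono card_high_le cen v t) simp
  also have "\<dots> = ?e * (real (card (centred M)) / (real M + 1))" by (simp add: field_simps)
  also have "\<dots> \<le> ?e * real (card (rooted v0))"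
  proof (intro mult_left_mono)
    have "real (card (centred M)) \<le> real ((M + 1) * card (rooted v0))" using cen(2) by (rule of_nat_mono)
    then show "real (card (centred M)) / (real M + 1) \<le> real (card (rooted v0))"
      by (simp add: field_simps)
  qed simp
  finally show ?thesis .
qed

end

section \<open>Shortest-path balls and phases\<close>

lemma awalk_relpow:
  "set p \<subseteq> E \<Longrightarrow> pcas u p w \<Longrightarrow> (u, w) \<in> E ^^ length p"
proof (induction p arbitrary: u)
  case (Cons e p)
  then have "(u, snd e) \<in> E" "(snd e, w) \<in> E ^^ length p" by (auto simp: prod_eq_iff)
  then show ?case by (simp only: list.size(4) add_Suc_right add_0_right) (rule relpow_Suc_I2)
qed simp

lemma graph_ball_relpow:
  assumes "pair_graph G" "w \<in> graph_ball G v t"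
  shows "\<exists>s\<le>t. (v, w) \<in> parcs G ^^ s"
proof -
  interpret pair_graph G by fact
  have cost: "awalk_cost (\<lambda>_. 1) p = real (length p)" for p by (induction p) simp_all
  have "wf_digraph.\<mu> (with_proj G) (\<lambda>_. 1) v w \<le> ereal (real t)"
    using assms(2) by (simp add: graph_ball_def)
  also have "\<dots> < ereal (real (Suc t))" by simp
  finally have "(INF p\<in>{p. pre_digraph.awalk (with_proj G) v p w}.
      ereal (awalk_cost (\<lambda>_. 1) p)) < ereal (real (Suc t))"
    by (simp add: wf_digraph.\<mu>_def[OF wf_digraph_axioms])
  then obtain p where p: "pre_digraph.awalk (with_proj G) v p w"
    and "awalk_cost (\<lambda>_. 1) p < real (Suc t)"
    unfolding INF_less_iff by auto
  then have "length p \<le> t" by (simp add: cost)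
  moreover have "(v, w) \<in> parcs G ^^ length p"
    using p by (intro awalk_relpow) (auto simp: awalk_def)
  ultimately show ?thesis by blast
qed

lemma int_dist_interval_le:
  assumes "0 \<le> r" "k - r \<le> b" "b \<le> k + int M + r"
  shows "int_dist b {k..k + int M} \<le> r"
proof -
  define a where "a = max k (min b (k + int M))"
  have "a \<in> {k..k + int M}" "\<bar>b - a\<bar> \<le> r" using assms by (auto simp: a_def)
  moreover have "bdd_below ((\<lambda>a. \<bar>b - a\<bar>) ` {k..k + int M})" by (rule bdd_belowI[of _ 0]) auto
  ultimately show ?thesis unfolding int_dist_def by (meson cINF_lower2)
qed

theorem theorem1p2:
  fixes G :: "'a pair_pre_digraph" and M d t :: nat and lam :: real and v0 v :: 'a
    and phase :: "('a \<Rightarrow> int) \<Rightarrow> int set"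
  assumes "pair_graph G" and "Digraph_Component.connected (with_proj G)"
    and "d \<ge> 1" and "M \<ge> 1"
    and "good_expander M d lam G"
    and "v0 \<in> pverts G"
    and "phase_assignment G d lam v0 M phase"
    and "t \<ge> 1" and "v \<in> pverts G"
  shows "measure_pmf.prob (pmf_of_set (Lip G v0 M))
           {f. int_dist (f v) (phase f) > (int t - 1) * int M}
         \<le> exp (- (real (card (graph_ball G v t)) / (5 * (real M + 1))))"
proof -
  interpret G: pair_graph G by fact
  have exp_G: "expander d lam G"
    and lam: "lam \<le> real d / (32 * (real M + 1) * ln (9 * real M * (real d)\<^sup>2))"
    using assms(5) by (auto simp: good_expander_def)
  have out: "out_arcs (with_proj G) x = Pair x ` (parcs G `` {x})" for x
    by (auto simp: out_arcs_def)
  have degree: "card (parcs G `` {x}) = d" if "x \<in> pverts G" for x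
  proof -
    have "out_degree (with_proj G) x = d"
      using exp_G that by (auto simp: expander_def regular_graph_def)
    then show ?thesis by (simp add: out_degree_def out card_image inj_on_def)
  qed
  interpret good_regular_expander "pverts G" "parcs G" d lam M "ln (9 * real M * (real d)\<^sup>2)"
  proof
    show "finite (pverts G)" by (rule G.pair_finite_verts)
    show "parcs G \<subseteq> pverts G \<times> pverts G" using G.in_arcsD1 G.in_arcsD2 by auto
    show "sym (parcs G)" using G.pair_sym_arcs by (simp add: symmetric_def)
    show "lam \<le> real d / (32 * ((real M + 1) * ln (9 * real M * (real d)\<^sup>2)))"
      using lam by (simp only: mult.assoc)
    fix S T assume "S \<subseteq> pverts G" "T \<subseteq> pverts G"
    then have "\<bar>real (edge_count G S T) - real d / real (card (pverts G)) * real (card S) * real (card T)\<bar>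
        \<le> lam * sqrt (real (card S) * real (card T))"
      using exp_G by (auto simp: expander_def)
    moreover have "{(a, b). a \<in> S \<and> b \<in> T \<and> (a, b) \<in> parcs G} = parcs G \<inter> S \<times> T" by auto
    ultimately show "real (card (parcs G \<inter> S \<times> T))
        \<le> real d / real (card (pverts G)) * real (card S) * real (card T)
          + lam * sqrt (real (card S) * real (card T))"
      by (simp add: edge_count_def abs_le_iff)
  qed (use assms(3,4) degree in auto)
  have conn: "(v0, x) \<in> (parcs G)\<^sup>*" if "x \<in> pverts G" for x
  proof -
    have "v0 \<rightarrow>\<^sup>*\<^bsub>with_proj (mk_symmetric (with_proj G))\<^esub> x"
      using assms(2) that assms(6)
      by (auto simp: Digraph_Component.connected_def strongly_connected_def)
    then have "v0 \<rightarrow>\<^sup>*\<^bsub>with_proj G\<^esub> x"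
      using G.reachable_mk_symmetric_eq[OF G.pair_sym_arcs] by simp
    then show ?thesis by (auto simp: reachable_def dest: rtrancl_on_rtranclI)
  qed
  have Lip: "Lip G v0 M = rooted v0"
    by (auto simp: Lip_def rooted_def lipschitz_def)
  have finL: "finite (rooted v0)" by (rule finite_rooted[OF conn])
  have zero: "(\<lambda>w\<in>pverts G. 0) \<in> rooted v0"
    using assms(6) E_in_V by (auto simp: rooted_def intro!: lipschitzI)
  define B where "B = rooted v0 \<inter> {f. int_dist (f v) (phase f) > (int t - 1) * int M}"
  have far: "\<exists>k. real (card {w \<in> pverts G. f w \<notin> {k..k + int M}})
        \<le> 2 * lam * real (card (pverts G)) / real d
      \<and> (f v > k + int t * int M \<or> f v < k + int M - int t * int M)" if f: "f \<in> B" for f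
  proof -
    have fr: "f \<in> Lip G v0 M" using f Lip by (simp add: B_def)
    have fd: "int_dist (f v) (phase f) > (int t - 1) * int M" using f by (simp add: B_def)
    have r: "(int t - 1) * int M \<ge> 0" using assms(8) by simp
    \<comment> \<open>The zero function has phase \<open>{0}\<close>, so it is at distance 0 from its phase.\<close>
    have "\<exists>w\<in>pverts G. f w \<noteq> 0"
    proof (rule ccontr)
      assume no: "\<not> (\<exists>w\<in>pverts G. f w \<noteq> 0)"
      then have "f = (\<lambda>w\<in>pverts G. 0)" using fr by (auto simp: Lip_def PiE_def extensional_def fun_eq_iff)
      then have "phase f = {0}" using assms(7) by (simp add: phase_assignment_def)
      moreover have "f v = 0" using no assms(9) by blast
      ultimately have "int_dist (f v) (phase f) = 0" by (simp add: int_dist_def)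
      then show False using fd r by simp
    qed
    then obtain k where k: "phase f = {k..k + int M}"
      "real (card {w \<in> pverts G. f w \<notin> {k..k + int M}}) \<le> 2 * lam * real (card (pverts G)) / real d"
      using assms(7) fr unfolding phase_assignment_def by blast
    have "f v > k + int M + (int t - 1) * int M \<or> f v < k - (int t - 1) * int M"
    proof (rule ccontr)
      assume "\<not> ?thesis"
      then have "int_dist (f v) (phase f) \<le> (int t - 1) * int M"
        unfolding k(1) by (intro int_dist_interval_le r) auto
      then show False using fd by simp
    qed
    then show ?thesis using k(2) by (intro exI[of _ k]) (simp add: algebra_simps)
  qed
  have "graph_ball G v t \<subseteq> ball v t"
    using graph_ball_relpow[OF assms(1)] by (fastforce simp: ball_def)
  moreover have "finite (ball v t)"
  proof (rule finite_subset)
    have "w \<in> pverts G" if "(v, w) \<in> parcs G ^^ s" for w s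
      using that assms(9) E_in_V by (cases s) auto
    then show "ball v t \<subseteq> pverts G" by (auto simp: ball_def)
  qed (rule finV)
  ultimately have ball: "card (graph_ball G v t) \<le> card (ball v t)" by (intro card_mono)
  have "measure_pmf.prob (pmf_of_set (Lip G v0 M))
          {f. int_dist (f v) (phase f) > (int t - 1) * int M}
      = real (card B) / real (card (rooted v0))"
    unfolding Lip B_def using zero finL by (intro measure_pmf_of_set) auto
  also have "\<dots> \<le> exp (- real (card (ball v t)) / (5 * (real M + 1)))"
  proof -
    have "real (card B)
        \<le> exp (- real (card (ball v t)) / (5 * (real M + 1))) * real (card (rooted v0))"
      using assms(6,9,8) conn far by (intro card_far_le) (auto simp: B_def)
    moreover have "card (rooted v0) > 0" using zero finL by (auto simp: card_gt_0_iff)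
    ultimately show ?thesis by (simp add: field_simps)
  qed
  also have "\<dots> \<le> exp (- (real (card (graph_ball G v t)) / (5 * (real M + 1))))"
    using ball by (simp add: divide_right_mono)
  finally show ?thesis .
qed

end
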